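(* Let $G$ be a nontrivial group. Then $\mathrm{soc}(G) = e(G)$ if and only if $\mathrm{soc}(G)$ is an essential subgroup of $e(G)$.
   Context: A normal subgroup $E$ of a group $G$ is called an essential subgroup of $G$ if every nontrivial normal subgroup of $G$ intersects $E$ nontrivially. $e(G)$ denotes the intersection of all essential subgroups of $G$ (note that $G$ is an essential subgroup of itself). The socle $\mathrm{soc}(G)$ is the subgroup of $G$ generated by all minimal normal subgroups of $G$; if $G$ has no minimal normal subgroups then $\mathrm{soc}(G) = \{1\}$. One has $\mathrm{soc}(G) \subseteq e(G)$. *)

theory Defs
  imports "HOL-Algebra.Algebra"
begin

definition essential_subgroup :: "'a set \<Rightarrow> ('a, 'b) monoid_scheme \<Rightarrow> bool" where
  "essential_subgroup E G \<longleftrightarrow>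
     E \<lhd> G \<and> (\<forall>N. N \<lhd> G \<and> N \<noteq> {\<one>\<^bsub>G\<^esub>} \<longrightarrow> N \<inter> E \<noteq> {\<one>\<^bsub>G\<^esub>})"

(* The carrier of G is itself essential when G is a group, so this is an intersection
   of a nonempty family. *)
definition essential_core :: "('a, 'b) monoid_scheme \<Rightarrow> 'a set" where
  "essential_core G = \<Inter> {E. essential_subgroup E G}"

definition minimal_normal_subgroup :: "'a set \<Rightarrow> ('a, 'b) monoid_scheme \<Rightarrow> bool" where
  "minimal_normal_subgroup N G \<longleftrightarrow>
     N \<lhd> G \<and> N \<noteq> {\<one>\<^bsub>G\<^esub>} \<and>
     (\<forall>M. M \<lhd> G \<and> M \<noteq> {\<one>\<^bsub>G\<^esub>} \<and> M \<subseteq> N \<longrightarrow> M = N)"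

(* If there are no minimal normal subgroups this is generate G {}, the trivial subgroup. *)
definition socle :: "('a, 'b) monoid_scheme \<Rightarrow> 'a set" where
  "socle G = generate G (\<Union> {N. minimal_normal_subgroup N G})"

end

(* If N is normal in G and C is maximal among the normal subgroups meeting N trivially, then
   CN is essential, so e(G) is contained in CN.  For N = soc(G) essential in e(G), the normal
   subgroup C \<inter> e(G) meets N trivially and is therefore trivial, and then e(G) = N by the
   modular law. *)

theory Submission
  imports Defs
begin

context group
begin

text \<open>The empty family is excluded because its intersection is the whole type rather than
  \<open>carrier G\<close>.\<close>

lemma normal_Inter:
  assumes "\<A> \<noteq> {}" and normal: "\<And>N. N \<in> \<A> \<Longrightarrow> N \<lhd> G"
  shows "\<Inter> \<A> \<lhd> G"
proof (rule normal_invI)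
  show "subgroup (\<Inter> \<A>) G"
    using assms by (intro subgroups_Inter) (auto dest: normal_imp_subgroup)
  show "x \<otimes> h \<otimes> inv x \<in> \<Inter> \<A>" if "x \<in> carrier G" "h \<in> \<Inter> \<A>" for x h
    using normal_invE(2)[OF normal] that by blast
qed

lemma normal_generate_Union:
  assumes "\<And>N. N \<in> \<A> \<Longrightarrow> N \<lhd> G"
  shows "generate G (\<Union> \<A>) \<lhd> G"
proof (rule normal_generateI)
  show "\<Union> \<A> \<subseteq> carrier G"
    using subgroup.subset[OF normal_imp_subgroup[OF assms]] by blast
  show "g \<otimes> h \<otimes> inv g \<in> \<Union> \<A>" if "h \<in> \<Union> \<A>" "g \<in> carrier G" for h g
    using normal_invE(2)[OF assms] that by blast
qed

text \<open>Provides the upper bounds for Zorn's lemma. Comparability matters for products: two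
  elements of the union already lie in the larger of two members.\<close>

lemma normal_Union_chain:
  assumes "\<C> \<noteq> {}" and normal: "\<And>N. N \<in> \<C> \<Longrightarrow> N \<lhd> G"
    and chain: "\<And>M N. M \<in> \<C> \<Longrightarrow> N \<in> \<C> \<Longrightarrow> M \<subseteq> N \<or> N \<subseteq> M"
  shows "\<Union> \<C> \<lhd> G"
proof (rule normal_invI)
  have subgroup: "subgroup N G" if "N \<in> \<C>" for N
    using normal[OF that] by (rule normal_imp_subgroup)
  show "subgroup (\<Union> \<C>) G"
  proof (rule subgroupI)
    show "\<Union> \<C> \<subseteq> carrier G"
      using subgroup.subset[OF subgroup] by blast
    show "\<Union> \<C> \<noteq> {}"
      using assms(1) subgroup.one_closed[OF subgroup] by blast
    show "inv a \<in> \<Union> \<C>" if "a \<in> \<Union> \<C>" for a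
      using that subgroup.m_inv_closed[OF subgroup] by blast
    show "a \<otimes> b \<in> \<Union> \<C>" if ab: "a \<in> \<Union> \<C>" "b \<in> \<Union> \<C>" for a b
    proof -
      obtain M N where "M \<in> \<C>" "a \<in> M" "N \<in> \<C>" "b \<in> N"
        using ab by blast
      then obtain K where "K \<in> \<C>" "a \<in> K" "b \<in> K"
        using chain[of M N] by blast
      then show ?thesis
        using subgroup.m_closed[OF subgroup] by blast
    qed
  qed
  show "x \<otimes> h \<otimes> inv x \<in> \<Union> \<C>" if "x \<in> carrier G" "h \<in> \<Union> \<C>" for x h
    using normal_invE(2)[OF normal] that by blast
qed

lemma subset_set_mult_left:
  assumes "subgroup H G" "subgroup K G"
  shows "H \<subseteq> H <#> K"
proof
  fix h assume "h \<in> H"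
  then have "h = h \<otimes> \<one>"
    using subgroup.mem_carrier[OF assms(1)] by simp
  then show "h \<in> H <#> K"
    using \<open>h \<in> H\<close> subgroup.one_closed[OF assms(2)] unfolding set_mult_def by blast
qed

lemma subset_set_mult_right:
  assumes "subgroup H G" "subgroup K G"
  shows "K \<subseteq> H <#> K"
proof
  fix k assume "k \<in> K"
  then have "k = \<one> \<otimes> k"
    using subgroup.mem_carrier[OF assms(2)] by simp
  then show "k \<in> H <#> K"
    using \<open>k \<in> K\<close> subgroup.one_closed[OF assms(1)] unfolding set_mult_def by blast
qed

text \<open>Zorn's lemma applies because meeting \<open>N\<close> trivially passes to unions of
  nonempty chains, intersection with \<open>N\<close> being distributive over unions.\<close>

lemma ex_maximal_normal_disjoint:
  assumes "N \<lhd> G"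
  obtains C where "C \<lhd> G" "C \<inter> N = {\<one>}"
    "\<And>D. D \<lhd> G \<Longrightarrow> D \<inter> N = {\<one>} \<Longrightarrow> C \<subseteq> D \<Longrightarrow> D = C"
proof -
  let ?A = "{C. C \<lhd> G \<and> C \<inter> N = {\<one>}}"
  have "\<exists>C\<in>?A. \<forall>D\<in>?A. C \<subseteq> D \<longrightarrow> D = C"
  \<comment> \<open>This form asks for bounds of nonempty chains only; the union of the empty chain
    would be the empty set, which is no subgroup.\<close>
  proof (rule subset_Zorn_nonempty)
    have "{\<one>} \<inter> N = {\<one>}"
      using subgroup.one_closed[OF normal_imp_subgroup[OF assms]] by simp
    then have "{\<one>} \<in> ?A"
      using one_is_normal by simp
    then show "?A \<noteq> {}"
      by (metis empty_iff)
  next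
    fix \<C> assume "\<C> \<noteq> {}" and chain: "subset.chain ?A \<C>"
    then have sub: "\<C> \<subseteq> ?A"
      by (simp add: subset.chain_def)
    have "\<Union> \<C> \<lhd> G"
    proof (rule normal_Union_chain)
      show "M \<subseteq> N \<or> N \<subseteq> M" if "M \<in> \<C>" "N \<in> \<C>" for M N
        using chain that unfolding subset_chain_def by metis
    qed (use \<open>\<C> \<noteq> {}\<close> sub in auto)
    moreover have "\<Union> \<C> \<inter> N = {\<one>}"
    proof -
      have "\<Union> \<C> \<inter> N = (\<Union>C\<in>\<C>. C \<inter> N)"
        by (rule Int_Union2)
      also have "\<dots> = (\<Union>C\<in>\<C>. {\<one>})"
        using sub by (intro SUP_cong) auto
      finally show ?thesis
        using \<open>\<C> \<noteq> {}\<close> by simp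
    qed
    ultimately show "\<Union> \<C> \<in> ?A"
      by blast
  qed
  then obtain C where "C \<in> ?A" and maximal: "\<forall>D\<in>?A. C \<subseteq> D \<longrightarrow> D = C" ..
  then show thesis
    using that[of C] by simp
qed

text \<open>If a normal \<open>K\<close> meets \<open>C <#> N\<close> trivially, then
  \<open>C <#> K\<close> still meets \<open>N\<close> trivially. Maximality absorbs \<open>K\<close>
  into \<open>C\<close>, hence into \<open>C <#> N\<close>, and so \<open>K\<close> is
  trivial.\<close>

lemma essential_set_mult_maximal_disjoint:
  assumes N: "N \<lhd> G" and C: "C \<lhd> G" "C \<inter> N = {\<one>}"
    and maximal: "\<And>D. D \<lhd> G \<Longrightarrow> D \<inter> N = {\<one>} \<Longrightarrow> C \<subseteq> D \<Longrightarrow> D = C"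
  shows "essential_subgroup (C <#> N) G"
  unfolding essential_subgroup_def
proof (intro conjI allI impI notI)
  show "C <#> N \<lhd> G"
    using C(1) N by (rule normal_subgroup_set_mult_closed)
next
  fix K assume "K \<lhd> G \<and> K \<noteq> {\<one>}" and disj: "K \<inter> (C <#> N) = {\<one>}"
  then have K: "K \<lhd> G" "K \<noteq> {\<one>}"
    by auto
  interpret C: subgroup C G using C(1) by (rule normal_imp_subgroup)
  interpret N: subgroup N G using N by (rule normal_imp_subgroup)
  interpret K: subgroup K G using K(1) by (rule normal_imp_subgroup)
  \<comment> \<open>From \<open>n = c \<otimes> k\<close> one gets
    \<open>k = inv c \<otimes> n\<close>, an element of both \<open>K\<close> and
    \<open>C <#> N\<close>. So \<open>k = \<one>\<close>, which puts \<open>n\<close> in both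
    \<open>C\<close> and \<open>N\<close>.\<close>
  have "(C <#> K) \<inter> N \<subseteq> {\<one>}"
  proof
    fix n assume n: "n \<in> (C <#> K) \<inter> N"
    then obtain c k where ck: "c \<in> C" "k \<in> K" "n = c \<otimes> k"
      unfolding set_mult_def by blast
    then have "k = inv c \<otimes> n"
      by (simp add: inv_solve_left)
    then have "k \<in> C <#> N"
      using ck n C.m_inv_closed unfolding set_mult_def by blast
    then have "k = \<one>"
      using disj ck by blast
    then have "n \<in> C"
      using ck by simp
    then show "n \<in> {\<one>}"
      using C(2) n by blast
  qed
  moreover have "\<one> \<in> (C <#> K) \<inter> N"
    using subset_set_mult_left[OF C.subgroup_axioms K.subgroup_axioms] by auto
  ultimately have "C <#> K = C"
    using normal_subgroup_set_mult_closed[OF C(1) K(1)]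
      subset_set_mult_left[OF C.subgroup_axioms K.subgroup_axioms]
    by (intro maximal) auto
  then have "K \<subseteq> C"
    using subset_set_mult_right[OF C.subgroup_axioms K.subgroup_axioms] by simp
  also have "C \<subseteq> C <#> N"
    using subset_set_mult_left[OF C.subgroup_axioms N.subgroup_axioms] .
  finally show False
    using disj K(2) by blast
qed

text \<open>Serves twice: it makes the family defining \<open>essential_core\<close> nonempty, and,
  applied to e(G) as a group in its own right, it yields the forward direction of the
  theorem.\<close>

lemma essential_subgroup_self: "essential_subgroup (carrier G) G"
proof -
  have "N \<inter> carrier G = N" if "N \<lhd> G" for N
    using subgroup.subset[OF normal_imp_subgroup[OF that]] by blast
  then show ?thesis
    unfolding essential_subgroup_def using normal_self by simp
qed

lemma essential_core_normal: "essential_core G \<lhd> G"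
  unfolding essential_core_def
proof (rule normal_Inter)
  show "{E. essential_subgroup E G} \<noteq> {}"
    using essential_subgroup_self by blast
qed (simp add: essential_subgroup_def)

lemma socle_normal: "socle G \<lhd> G"
  unfolding socle_def
  by (rule normal_generate_Union) (simp add: minimal_normal_subgroup_def)

text \<open>Normality of \<open>N\<close> in all of \<open>G\<close>, not just in e(G), is what lets
  a maximal complement-like \<open>C\<close> produce an essential subgroup \<open>C <#> N\<close> of
  \<open>G\<close>.\<close>

lemma essential_in_essential_core_imp_eq:
  assumes N: "N \<lhd> G" and ess: "essential_subgroup N (G\<lparr>carrier := essential_core G\<rparr>)"
  shows "N = essential_core G"
proof
  let ?e = "essential_core G"
  interpret e: subgroup ?e G
    using essential_core_normal by (rule normal_imp_subgroup)
  interpret N: subgroup N G using N by (rule normal_imp_subgroup)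
  have "N \<lhd> G\<lparr>carrier := ?e\<rparr>"
    using ess by (simp add: essential_subgroup_def)
  then show "N \<subseteq> ?e"
    using subgroup.subset[OF normal_imp_subgroup] by fastforce
  obtain C where C: "C \<lhd> G" "C \<inter> N = {\<one>}"
    and maximal: "\<And>D. D \<lhd> G \<Longrightarrow> D \<inter> N = {\<one>} \<Longrightarrow> C \<subseteq> D \<Longrightarrow> D = C"
    using ex_maximal_normal_disjoint[OF N] by blast
  interpret C: subgroup C G using C(1) by (rule normal_imp_subgroup)
  \<comment> \<open>Essentiality of \<open>N\<close> tests only normal subgroups of e(G), so
    \<open>C\<close> has to be cut down to e(G) first.\<close>
  have "C \<inter> ?e \<lhd> G\<lparr>carrier := ?e\<rparr>"
    using e.subgroup_axioms C(1) by (rule normal_Int_subgroup)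
  moreover have "(C \<inter> ?e) \<inter> N = {\<one>}"
    using C(2) e.one_closed by blast
  ultimately have trivial: "C \<inter> ?e = {\<one>}"
    using ess unfolding essential_subgroup_def by auto
  have "?e \<subseteq> C <#> N"
    using essential_set_mult_maximal_disjoint[OF N C maximal]
    unfolding essential_core_def by blast
  show "?e \<subseteq> N"
  proof
    fix x assume x: "x \<in> ?e"
    then obtain c n where cn: "c \<in> C" "n \<in> N" "x = c \<otimes> n"
      using \<open>?e \<subseteq> C <#> N\<close> unfolding set_mult_def by blast
    \<comment> \<open>The modular law on elements: since \<open>N \<subseteq> ?e\<close>, the factor
      \<open>c\<close> lies in e(G) as well, hence in the trivial
      \<open>C \<inter> ?e\<close>.\<close>
    then have "c = x \<otimes> inv n"
      by (simp add: inv_solve_right)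
    then have "c \<in> ?e"
      using x cn \<open>N \<subseteq> ?e\<close> by blast
    then have "c = \<one>"
      using trivial cn by blast
    then show "x \<in> N"
      using cn by simp
  qed
qed

end

theorem theorem2p9:
  fixes G :: "('a, 'b) monoid_scheme"
  assumes "group G"
    and "carrier G \<noteq> {\<one>\<^bsub>G\<^esub>}"
  shows "socle G = essential_core G \<longleftrightarrow>
         essential_subgroup (socle G) (G\<lparr>carrier := essential_core G\<rparr>)"
proof
  interpret group G by fact
  assume "socle G = essential_core G"
  moreover have "group (G\<lparr>carrier := essential_core G\<rparr>)"
    by (intro subgroup_imp_group normal_imp_subgroup essential_core_normal)
  \<comment> \<open>Under the assumed equality the socle is the full carrier of the restricted
    group.\<close>
  ultimately show "essential_subgroup (socle G) (G\<lparr>carrier := essential_core G\<rparr>)"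
    using group.essential_subgroup_self[of "G\<lparr>carrier := essential_core G\<rparr>"] by simp
next
  assume "essential_subgroup (socle G) (G\<lparr>carrier := essential_core G\<rparr>)"
  then show "socle G = essential_core G"
    using group.socle_normal[OF assms(1)]
    by (intro group.essential_in_essential_core_imp_eq[OF assms(1)])
qed

end
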